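(* The class of ditopological inverse semigroups includes: all topological groups; all topological semilattices; all compact Hausdorff topological inverse semigroups; and all discrete topological inverse semigroups.
   Context: A topological semigroup is a non-empty topological space with a continuous associative binary operation. A semigroup $S$ is inverse if for each $x\in S$ there is a unique element $x^{-1}\in S$ such that $xx^{-1}x=x$ and $x^{-1}xx^{-1}=x^{-1}$. A topological inverse semigroup is an inverse semigroup $S$ endowed with a topology such that the multiplication $S\times S\to S$ and the inversion $x\mapsto x^{-1}$ are continuous. A topological semilattice is a commutative topological semigroup $S$ with $xx=x$ for all $x\in S$; it is a topological inverse semigroup with $x^{-1}=x$. On a topological inverse semigroup $S$ consider the canonical operations $\lambda(x)=xx^{-1}$ and $\rho(x)=x^{-1}x$; they are continuous and satisfy $\lambda(x)x=x=x\rho(x)$. For $A,B\subset S$ put $A\leftthreetimes B=\{x\in S: ax\in B \text{ for some } a\in A\}$ and $B\rightthreetimes A=\{x\in S: xa\in B\text{ for some }a\in A\}$. The operation $\lambda$ is dicontinuous if for every $x\in S$ and every neighborhood $O_x\subset S$ of $x$ there are a neighborhood $U_x\subset S$ of $x$ and a neighborhood $W_{\lambda(x)}\subset\lambda(S)$ of $\lambda(x)$ in the subspace $\lambda(S)$ such that $(W_{\lambda(x)}\leftthreetimes U_x)\cap\lambda^{-1}(W_{\lambda(x)})\subset O_x$. The operation $\rho$ is dicontinuous if for every $x\in S$ and every neighborhood $O_x\subset S$ of $x$ there are a neighborhood $U_x\subset S$ of $x$ and a neighborhood $W_{\rho(x)}\subset\rho(S)$ of $\rho(x)$ in the subspace $\rho(S)$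 such that $(U_x\rightthreetimes W_{\rho(x)})\cap\rho^{-1}(W_{\rho(x)})\subset O_x$. A ditopological inverse semigroup is a topological inverse semigroup $S$ for which both canonical operations $\lambda$ and $\rho$ are dicontinuous. *)

theory Defs
  imports "HOL-Analysis.Analysis" "HOL-Algebra.Group"
begin

text \<open>
  Throughout, the semigroup is the carrier \<open>topspace X\<close> of an abstract topology \<open>X\<close>, with
  the operation given by a curried function \<open>m\<close> whose values are relevant on the carrier only.
  Spaces are not assumed to be Hausdorff.
\<close>

definition topological_semigroup :: "'a topology \<Rightarrow> ('a \<Rightarrow> 'a \<Rightarrow> 'a) \<Rightarrow> bool" where
  "topological_semigroup X m \<longleftrightarrow>
     topspace X \<noteq> {} \<and>
     continuous_map (prod_topology X X) X (\<lambda>(x, y). m x y) \<and>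
     (\<forall>x\<in>topspace X. \<forall>y\<in>topspace X. \<forall>z\<in>topspace X. m (m x y) z = m x (m y z))"

definition is_inverse_of :: "('a \<Rightarrow> 'a \<Rightarrow> 'a) \<Rightarrow> 'a \<Rightarrow> 'a \<Rightarrow> bool" where
  "is_inverse_of m x y \<longleftrightarrow> m (m x y) x = x \<and> m (m y x) y = y"

definition inverse_semigroup :: "'a set \<Rightarrow> ('a \<Rightarrow> 'a \<Rightarrow> 'a) \<Rightarrow> bool" where
  "inverse_semigroup S m \<longleftrightarrow>
     S \<noteq> {} \<and>
     (\<forall>x\<in>S. \<forall>y\<in>S. m x y \<in> S) \<and>
     (\<forall>x\<in>S. \<forall>y\<in>S. \<forall>z\<in>S. m (m x y) z = m x (m y z)) \<and>
     (\<forall>x\<in>S. \<exists>!y. y \<in> S \<and> is_inverse_of m x y)"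

definition sg_inv :: "'a set \<Rightarrow> ('a \<Rightarrow> 'a \<Rightarrow> 'a) \<Rightarrow> 'a \<Rightarrow> 'a" where
  "sg_inv S m x = (THE y. y \<in> S \<and> is_inverse_of m x y)"

definition topological_inverse_semigroup :: "'a topology \<Rightarrow> ('a \<Rightarrow> 'a \<Rightarrow> 'a) \<Rightarrow> bool" where
  "topological_inverse_semigroup X m \<longleftrightarrow>
     inverse_semigroup (topspace X) m \<and>
     continuous_map (prod_topology X X) X (\<lambda>(x, y). m x y) \<and>
     continuous_map X X (sg_inv (topspace X) m)"

definition topological_semilattice :: "'a topology \<Rightarrow> ('a \<Rightarrow> 'a \<Rightarrow> 'a) \<Rightarrow> bool" where
  "topological_semilattice X m \<longleftrightarrow>
     topological_semigroup X m \<and>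
     (\<forall>x\<in>topspace X. \<forall>y\<in>topspace X. m x y = m y x) \<and>
     (\<forall>x\<in>topspace X. m x x = x)"

definition topological_group :: "'a topology \<Rightarrow> ('a, 'b) monoid_scheme \<Rightarrow> bool" where
  "topological_group X G \<longleftrightarrow>
     group G \<and>
     topspace X = carrier G \<and>
     continuous_map (prod_topology X X) X (\<lambda>(x, y). x \<otimes>\<^bsub>G\<^esub> y) \<and>
     continuous_map X X (\<lambda>x. inv\<^bsub>G\<^esub> x)"

definition sg_lambda :: "'a set \<Rightarrow> ('a \<Rightarrow> 'a \<Rightarrow> 'a) \<Rightarrow> 'a \<Rightarrow> 'a" where
  "sg_lambda S m x = m x (sg_inv S m x)"

definition sg_rho :: "'a set \<Rightarrow> ('a \<Rightarrow> 'a \<Rightarrow> 'a) \<Rightarrow> 'a \<Rightarrow> 'a" where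
  "sg_rho S m x = m (sg_inv S m x) x"

text \<open>\<open>left_div S m A B\<close> is \<open>A \<leftthreetimes> B\<close>, and \<open>right_div S m B A\<close> is \<open>B \<rightthreetimes> A\<close>.\<close>

definition left_div :: "'a set \<Rightarrow> ('a \<Rightarrow> 'a \<Rightarrow> 'a) \<Rightarrow> 'a set \<Rightarrow> 'a set \<Rightarrow> 'a set" where
  "left_div S m A B = {x \<in> S. \<exists>a\<in>A. m a x \<in> B}"

definition right_div :: "'a set \<Rightarrow> ('a \<Rightarrow> 'a \<Rightarrow> 'a) \<Rightarrow> 'a set \<Rightarrow> 'a set \<Rightarrow> 'a set" where
  "right_div S m B A = {x \<in> S. \<exists>a\<in>A. m x a \<in> B}"

text \<open>Neighborhoods need not be open.\<close>

definition nbhd_of :: "'a topology \<Rightarrow> 'a \<Rightarrow> 'a set \<Rightarrow> bool" where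
  "nbhd_of X x N \<longleftrightarrow> N \<subseteq> topspace X \<and> (\<exists>U. openin X U \<and> x \<in> U \<and> U \<subseteq> N)"

definition lambda_dicontinuous :: "'a topology \<Rightarrow> ('a \<Rightarrow> 'a \<Rightarrow> 'a) \<Rightarrow> bool" where
  "lambda_dicontinuous X m \<longleftrightarrow>
     (let S = topspace X; l = sg_lambda S m in
       \<forall>x\<in>S. \<forall>Ox. nbhd_of X x Ox \<longrightarrow>
         (\<exists>U W. nbhd_of X x U \<and> nbhd_of (subtopology X (l ` S)) (l x) W \<and>
           left_div S m W U \<inter> {y \<in> S. l y \<in> W} \<subseteq> Ox))"

definition rho_dicontinuous :: "'a topology \<Rightarrow> ('a \<Rightarrow> 'a \<Rightarrow> 'a) \<Rightarrow> bool" where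
  "rho_dicontinuous X m \<longleftrightarrow>
     (let S = topspace X; r = sg_rho S m in
       \<forall>x\<in>S. \<forall>Ox. nbhd_of X x Ox \<longrightarrow>
         (\<exists>U W. nbhd_of X x U \<and> nbhd_of (subtopology X (r ` S)) (r x) W \<and>
           right_div S m U W \<inter> {y \<in> S. r y \<in> W} \<subseteq> Ox))"

definition ditopological_inverse_semigroup :: "'a topology \<Rightarrow> ('a \<Rightarrow> 'a \<Rightarrow> 'a) \<Rightarrow> bool" where
  "ditopological_inverse_semigroup X m \<longleftrightarrow>
     topological_inverse_semigroup X m \<and> lambda_dicontinuous X m \<and> rho_dicontinuous X m"

end

theory Submission
  imports Defs
begin

text \<open>
  If $\lambda(y) = \lambda(x)$ then $y = \lambda(y) y = \lambda(x) y$, so the condition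
  $\lambda(x) y = x$ forces $y = x$. This settles the discrete case, and in the compact
  Hausdorff case it says that the point $(\lambda(x), x, \lambda(x))$ is not in the projection of
  the closed set $\{(w, u, v, y) : y \notin O_x,\ wy = u,\ \lambda(y) = v\}$ along the compact
  factor of $y$; since this projection is closed, a box around the point avoids it.
  For groups $\lambda$ is constant and for semilattices it is the identity.
  The statements about $\rho$ are those about $\lambda$ in the opposite semigroup.
\<close>

section \<open>Inverses and the operation lambda in an inverse semigroup\<close>

lemma inverse_semigroup_closed:
  "inverse_semigroup S m \<Longrightarrow> x \<in> S \<Longrightarrow> y \<in> S \<Longrightarrow> m x y \<in> S"
  by (simp add: inverse_semigroup_def)

lemma inverse_semigroup_assoc:
  "inverse_semigroup S m \<Longrightarrow> x \<in> S \<Longrightarrow> y \<in> S \<Longrightarrow> z \<in> S \<Longrightarrow> m (m x y) z = m x (m y z)"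
  by (simp add: inverse_semigroup_def)

lemma sg_inv:
  assumes "inverse_semigroup S m" "x \<in> S"
  shows "sg_inv S m x \<in> S" "is_inverse_of m x (sg_inv S m x)"
proof -
  have "\<exists>!y. y \<in> S \<and> is_inverse_of m x y"
    using assms by (simp add: inverse_semigroup_def)
  from theI'[OF this] show "sg_inv S m x \<in> S" "is_inverse_of m x (sg_inv S m x)"
    by (simp_all add: sg_inv_def)
qed

lemma sg_inv_eqI:
  assumes "inverse_semigroup S m" "x \<in> S" "y \<in> S" "is_inverse_of m x y"
  shows "sg_inv S m x = y"
  using assms sg_inv[OF assms(1,2)] by (auto simp: inverse_semigroup_def)

lemma sg_lambda_closed:
  "inverse_semigroup S m \<Longrightarrow> x \<in> S \<Longrightarrow> sg_lambda S m x \<in> S"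
  by (simp add: sg_lambda_def sg_inv inverse_semigroup_closed)

text \<open>This is the first equation of \<open>is_inverse_of\<close>. The constant, discrete and
  compact cases below all rest on it.\<close>

lemma sg_lambda_mult:
  "inverse_semigroup S m \<Longrightarrow> x \<in> S \<Longrightarrow> m (sg_lambda S m x) x = x"
  using sg_inv(2) by (fastforce simp: sg_lambda_def is_inverse_of_def)

lemma continuous_map_sg_lambda:
  assumes "topological_inverse_semigroup X m"
  shows "continuous_map X X (sg_lambda (topspace X) m)"
proof -
  have "continuous_map X (prod_topology X X) (\<lambda>x. (x, sg_inv (topspace X) m x))"
    using assms by (simp add: continuous_map_pairedI topological_inverse_semigroup_def)
  moreover have "continuous_map (prod_topology X X) X (\<lambda>(x, y). m x y)"
    using assms by (simp add: topological_inverse_semigroup_def)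
  ultimately have "continuous_map X X ((\<lambda>(x, y). m x y) \<circ> (\<lambda>x. (x, sg_inv (topspace X) m x)))"
    by (rule continuous_map_compose)
  then show ?thesis
    by (simp add: o_def sg_lambda_def[abs_def])
qed

section \<open>The opposite semigroup\<close>

lemma inverse_semigroup_opposite:
  assumes "inverse_semigroup S m"
  shows "inverse_semigroup S (\<lambda>x y. m y x)"
    and "x \<in> S \<Longrightarrow> sg_inv S (\<lambda>x y. m y x) x = sg_inv S m x"
    and "x \<in> S \<Longrightarrow> sg_lambda S (\<lambda>x y. m y x) x = sg_rho S m x"
proof -
  \<comment> \<open>Reversal turns \<open>m (m x y) x\<close> into \<open>m x (m y x)\<close>, so
    associativity gives the equivalence. Membership of \<open>y\<close> stays in the formula because
    associativity holds on \<open>S\<close> only and because this is the predicate under the unique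
    existence and under \<open>THE\<close>.\<close>
  have iff: "(y \<in> S \<and> is_inverse_of (\<lambda>x y. m y x) x y) = (y \<in> S \<and> is_inverse_of m x y)"
    if "x \<in> S" for x y
    using that inverse_semigroup_assoc[OF assms] by (auto simp: is_inverse_of_def)
  show "inverse_semigroup S (\<lambda>x y. m y x)"
    using assms by (simp add: inverse_semigroup_def iff)
  show inv: "x \<in> S \<Longrightarrow> sg_inv S (\<lambda>x y. m y x) x = sg_inv S m x" for x
    by (simp add: sg_inv_def iff)
  show "x \<in> S \<Longrightarrow> sg_lambda S (\<lambda>x y. m y x) x = sg_rho S m x"
    by (simp add: sg_lambda_def sg_rho_def inv)
qed

lemma topological_inverse_semigroup_opposite:
  assumes "topological_inverse_semigroup X m"
  shows "topological_inverse_semigroup X (\<lambda>x y. m y x)"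
proof -
  have isg: "inverse_semigroup (topspace X) m"
    and m: "continuous_map (prod_topology X X) X (\<lambda>(x, y). m x y)"
    and inv: "continuous_map X X (sg_inv (topspace X) m)"
    using assms by (simp_all add: topological_inverse_semigroup_def)
  have "continuous_map (prod_topology X X) (prod_topology X X) (\<lambda>p. (snd p, fst p))"
    by (intro continuous_map_pairedI continuous_map_fst continuous_map_snd)
  from continuous_map_compose[OF this m] have "continuous_map (prod_topology X X) X (\<lambda>(x, y). m y x)"
    by (simp add: o_def case_prod_unfold)
  \<comment> \<open>The two inversions are known to agree on the carrier only, which is enough for
    continuity.\<close>
  moreover have "continuous_map X X (sg_inv (topspace X) (\<lambda>x y. m y x))"
    using inv by (rule continuous_map_eq) (simp add: inverse_semigroup_opposite(2)[OF isg])
  ultimately show ?thesis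
    using inverse_semigroup_opposite(1)[OF isg] by (simp add: topological_inverse_semigroup_def)
qed

text \<open>Reversal exchanges lambda with rho and \<open>left_div\<close> with
  \<open>right_div\<close>. Since lambda of the opposite equals rho only pointwise on the carrier,
  the image and the preimages are rewritten separately.\<close>

lemma rho_dicontinuous_opposite:
  assumes "inverse_semigroup (topspace X) m" "lambda_dicontinuous X (\<lambda>x y. m y x)"
  shows "rho_dicontinuous X m"
proof -
  let ?S = "topspace X"
  note eq = inverse_semigroup_opposite(3)[OF assms(1)]
  have "sg_lambda ?S (\<lambda>x y. m y x) ` ?S = sg_rho ?S m ` ?S"
    using eq by (rule image_cong[OF refl])
  moreover have "{y \<in> ?S. sg_lambda ?S (\<lambda>x y. m y x) y \<in> W} = {y \<in> ?S. sg_rho ?S m y \<in> W}" for W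
    using eq by auto
  moreover have "left_div ?S (\<lambda>x y. m y x) W U = right_div ?S m U W" for U W
    by (simp add: left_div_def right_div_def)
  ultimately show ?thesis
    using assms(2) by (simp add: lambda_dicontinuous_def rho_dicontinuous_def Let_def eq)
qed

section \<open>Criteria for the dicontinuity of lambda\<close>

text \<open>Replaces neighborhoods by open sets and takes \<open>W\<close> open in the whole space,
  so that no subspace topology appears in the applications.\<close>

lemma lambda_dicontinuousI:
  fixes X m
  defines "l \<equiv> sg_lambda (topspace X) m"
  assumes ex: "\<And>x V. openin X V \<Longrightarrow> x \<in> V \<Longrightarrow>
      \<exists>U W. openin X U \<and> x \<in> U \<and> openin X W \<and> l x \<in> W \<and>
        (\<forall>w \<in> W \<inter> l ` topspace X. \<forall>y \<in> topspace X. m w y \<in> U \<and> l y \<in> W \<longrightarrow> y \<in> V)"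
  shows "lambda_dicontinuous X m"
  unfolding lambda_dicontinuous_def Let_def l_def[symmetric]
proof (intro ballI allI impI)
  fix x N
  assume x: "x \<in> topspace X" and "nbhd_of X x N"
  then obtain V where V: "openin X V" "x \<in> V" "V \<subseteq> N"
    by (auto simp: nbhd_of_def)
  obtain U W where U: "openin X U" "x \<in> U" and W: "openin X W" "l x \<in> W"
    and *: "\<forall>w \<in> W \<inter> l ` topspace X. \<forall>y \<in> topspace X. m w y \<in> U \<and> l y \<in> W \<longrightarrow> y \<in> V"
    using ex[OF V(1,2)] by blast
  have "nbhd_of X x U"
    using U by (auto simp: nbhd_of_def dest: openin_subset)
  \<comment> \<open>The trace of \<open>W\<close> on the image of \<open>l\<close> serves as the
    neighborhood in the subspace.\<close>
  moreover have "openin (subtopology X (l ` topspace X)) (W \<inter> l ` topspace X)"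
    using W(1) by (auto simp: openin_subtopology)
  then have "nbhd_of (subtopology X (l ` topspace X)) (l x) (W \<inter> l ` topspace X)"
    using W(2) x openin_subset unfolding nbhd_of_def by blast
  moreover have "left_div (topspace X) m (W \<inter> l ` topspace X) U \<inter>
      {y \<in> topspace X. l y \<in> W \<inter> l ` topspace X} \<subseteq> N"
    using * V(3) by (auto simp: left_div_def)
  ultimately show "\<exists>U W. nbhd_of X x U \<and> nbhd_of (subtopology X (l ` topspace X)) (l x) W \<and>
      left_div (topspace X) m W U \<inter> {y \<in> topspace X. l y \<in> W} \<subseteq> N"
    by blast
qed

text \<open>The only value \<open>w\<close> can take is \<open>e\<close>, and
  \<open>m e y = y\<close> because \<open>e\<close> is lambda of \<open>y\<close>. Hence
  \<open>U = V\<close> works, with the whole space as \<open>W\<close>.\<close>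

lemma lambda_dicontinuous_constant:
  assumes isg: "inverse_semigroup (topspace X) m"
    and const: "\<And>x. x \<in> topspace X \<Longrightarrow> sg_lambda (topspace X) m x = e"
  shows "lambda_dicontinuous X m"
proof (rule lambda_dicontinuousI, intro exI conjI)
  fix x V
  assume V: "openin X V" "x \<in> V"
  then have x: "x \<in> topspace X"
    using openin_subset by blast
  show "openin X V" "x \<in> V" "openin X (topspace X)"
    using V by simp_all
  show "sg_lambda (topspace X) m x \<in> topspace X"
    using isg x by (rule sg_lambda_closed)
  show "\<forall>w \<in> topspace X \<inter> sg_lambda (topspace X) m ` topspace X. \<forall>y \<in> topspace X.
      m w y \<in> V \<and> sg_lambda (topspace X) m y \<in> topspace X \<longrightarrow> y \<in> V"
    using sg_lambda_mult[OF isg] const by fastforce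
qed

lemma lambda_dicontinuous_identity:
  assumes isg: "inverse_semigroup (topspace X) m"
    and ident: "\<And>x. x \<in> topspace X \<Longrightarrow> sg_lambda (topspace X) m x = x"
  shows "lambda_dicontinuous X m"
proof (rule lambda_dicontinuousI)
  fix x V
  assume V: "openin X V" "x \<in> V"
  then have x: "x \<in> topspace X"
    using openin_subset by blast
  show "\<exists>U W. openin X U \<and> x \<in> U \<and> openin X W \<and> sg_lambda (topspace X) m x \<in> W \<and>
      (\<forall>w \<in> W \<inter> sg_lambda (topspace X) m ` topspace X. \<forall>y \<in> topspace X.
        m w y \<in> U \<and> sg_lambda (topspace X) m y \<in> W \<longrightarrow> y \<in> V)"
    \<comment> \<open>The rule is applied to both quantifiers, so \<open>U\<close> and
      \<open>W\<close> are both \<open>V\<close>; then lambda of \<open>y\<close> lying in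
      \<open>W\<close> already says that \<open>y\<close> lies in \<open>V\<close>.\<close>
    using V x ident by (intro exI[of _ V]) auto
qed

lemma lambda_dicontinuous_discrete:
  assumes isg: "inverse_semigroup (topspace X) m"
    and discrete: "X = discrete_topology (topspace X)"
  shows "lambda_dicontinuous X m"
proof (rule lambda_dicontinuousI)
  fix x V
  let ?l = "sg_lambda (topspace X) m"
  assume V: "openin X V" "x \<in> V"
  then have x: "x \<in> topspace X"
    using openin_subset by blast
  have sing: "openin X {y}" if "y \<in> topspace X" for y
    using that by (subst discrete) simp
  have *: "y \<in> V" if "y \<in> topspace X" "m (?l x) y = x" "?l y = ?l x" for y
    using sg_lambda_mult[OF isg that(1)] that(2,3) V(2) by metis
  show "\<exists>U W. openin X U \<and> x \<in> U \<and> openin X W \<and> ?l x \<in> W \<and>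
      (\<forall>w \<in> W \<inter> ?l ` topspace X. \<forall>y \<in> topspace X. m w y \<in> U \<and> ?l y \<in> W \<longrightarrow> y \<in> V)"
  proof (intro exI conjI ballI impI)
    \<comment> \<open>These goals fix the witnesses \<open>U = {x}\<close> and
      \<open>W = {?l x}\<close>; the two memberships left over are closed at the end.\<close>
    show "openin X {x}" "openin X {?l x}"
      using x isg by (simp_all add: sing sg_lambda_closed)
    show "y \<in> V" if "w \<in> {?l x} \<inter> ?l ` topspace X" "y \<in> topspace X"
        "m w y \<in> {x} \<and> ?l y \<in> {?l x}" for w y
      using * that by (metis IntD1 singletonD)
  qed (rule singletonI)+
qed

text \<open>The Hausdorff property makes each of the two equations define a closed set, and
  compactness makes the projection that forgets \<open>y\<close> a closed map.\<close>

lemma lambda_dicontinuous_compact_Hausdorff: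
  assumes tis: "topological_inverse_semigroup X m"
    and compact: "compact_space X" and Hausdorff: "Hausdorff_space X"
  shows "lambda_dicontinuous X m"
proof -
  let ?S = "topspace X"
  define l where "l = sg_lambda ?S m"
  have isg: "inverse_semigroup ?S m"
    and m: "continuous_map (prod_topology X X) X (\<lambda>(x, y). m x y)"
    using tis by (simp_all add: topological_inverse_semigroup_def)
  have l: "continuous_map X X l"
    unfolding l_def using tis by (rule continuous_map_sg_lambda)
  \<comment> \<open>Points of \<open>T\<close> have the form \<open>((w, u, v), y)\<close>. The
    coordinates \<open>u\<close> and \<open>v\<close> stand for the values \<open>m w y\<close> and
    \<open>l y\<close>, so that a box in \<open>P\<close> bounds these values and \<open>w\<close>
    without mentioning \<open>y\<close>.\<close>
  define P where "P = prod_topology X (prod_topology X X)"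
  define T where "T = prod_topology P X"
  have p: "continuous_map T P fst" and y: "continuous_map T X snd"
    unfolding T_def by (rule continuous_map_fst, rule continuous_map_snd)
  have p1: "continuous_map P X fst" and p2: "continuous_map P (prod_topology X X) snd"
    unfolding P_def by (rule continuous_map_fst, rule continuous_map_snd)
  have w: "continuous_map T X (\<lambda>q. fst (fst q))"
    using continuous_map_compose[OF p p1] by (simp add: o_def)
  have pq: "continuous_map T (prod_topology X X) (\<lambda>q. snd (fst q))"
    using continuous_map_compose[OF p p2] by (simp add: o_def)
  have u: "continuous_map T X (\<lambda>q. fst (snd (fst q)))"
    using continuous_map_compose[OF pq continuous_map_fst] by (simp add: o_def)
  have v: "continuous_map T X (\<lambda>q. snd (snd (fst q)))"
    using continuous_map_compose[OF pq continuous_map_snd] by (simp add: o_def)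
  have wy: "continuous_map T X (\<lambda>q. m (fst (fst q)) (snd q))"
    using continuous_map_compose[OF continuous_map_pairedI[OF w y] m] by (simp add: o_def)
  have ly: "continuous_map T X (\<lambda>q. l (snd q))"
    using continuous_map_compose[OF y l] by (simp add: o_def)
  have "\<exists>U W. openin X U \<and> x \<in> U \<and> openin X W \<and> l x \<in> W \<and>
        (\<forall>w \<in> W \<inter> l ` ?S. \<forall>y \<in> ?S. m w y \<in> U \<and> l y \<in> W \<longrightarrow> y \<in> V)"
    if V: "openin X V" "x \<in> V" for x V
  proof -
    have x: "x \<in> ?S"
      using V openin_subset by blast
    then have lx: "l x \<in> ?S"
      using isg by (simp add: l_def sg_lambda_closed)
    \<comment> \<open>\<open>F\<close> collects the failures: \<open>y\<close> lies outside
      \<open>V\<close> although its values are the prescribed \<open>u\<close> and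
      \<open>v\<close>.\<close>
    define F where "F = {q \<in> topspace T. snd q \<in> ?S - V} \<inter>
      {q \<in> topspace T. m (fst (fst q)) (snd q) = fst (snd (fst q))} \<inter>
      {q \<in> topspace T. l (snd q) = snd (snd (fst q))}"
    have "closedin T F"
      unfolding F_def
      using closedin_continuous_map_preimage[OF y, of "?S - V"] V(1)
        closedin_continuous_maps_eq[OF Hausdorff wy u]
        closedin_continuous_maps_eq[OF Hausdorff ly v]
      by (intro closedin_Int) auto
    then have "closedin P (fst ` F)"
      using closed_map_fst[OF compact, of P] by (simp add: closed_map_def T_def)
    then have "openin P (topspace P - fst ` F)"
      by blast
    moreover have "(l x, x, l x) \<notin> fst ` F"
    proof
      assume "(l x, x, l x) \<in> fst ` F"
      then obtain y where "y \<in> ?S" "y \<notin> V" "m (l x) y = x" "l y = l x"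
        by (auto simp: F_def T_def)
      with sg_lambda_mult[OF isg, of y] V(2) show False
        unfolding l_def by metis
    qed
    then have "(l x, x, l x) \<in> topspace P - fst ` F"
      using x lx by (simp add: P_def)
    \<comment> \<open>The product is nested, so the box \<open>W1 \<times> (U \<times> W2)\<close>
      is extracted in two stages.\<close>
    ultimately have "\<exists>W1 B. openin X W1 \<and> openin (prod_topology X X) B \<and>
        l x \<in> W1 \<and> (x, l x) \<in> B \<and> W1 \<times> B \<subseteq> topspace P - fst ` F"
      unfolding P_def openin_prod_topology_alt[of X "prod_topology X X"] by (elim allE impE)
    then obtain W1 B where W1: "openin X W1" "l x \<in> W1"
      and B: "openin (prod_topology X X) B" "(x, l x) \<in> B" and sub: "W1 \<times> B \<subseteq> topspace P - fst ` F"
      by (elim exE conjE)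
    from B have "\<exists>U W2. openin X U \<and> openin X W2 \<and> x \<in> U \<and> l x \<in> W2 \<and> U \<times> W2 \<subseteq> B"
      unfolding openin_prod_topology_alt by (elim allE impE)
    then obtain U W2 where U: "openin X U" "x \<in> U" and W2: "openin X W2" "l x \<in> W2"
      and sub2: "U \<times> W2 \<subseteq> B"
      by (elim exE conjE)
    \<comment> \<open>Dicontinuity uses one neighborhood for both \<open>w\<close> and
      \<open>l y\<close>, hence the intersection of \<open>W1\<close> and \<open>W2\<close>. A
      \<open>y\<close> outside \<open>V\<close> would give a point of \<open>F\<close> whose
      projection lies in the box.\<close>
    have "y \<in> V" if w: "w \<in> W1 \<inter> W2" and y: "y \<in> ?S" "m w y \<in> U" "l y \<in> W1 \<inter> W2" for w y
    proof (rule ccontr)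
      assume "y \<notin> V"
      moreover have in_box: "(w, m w y, l y) \<in> W1 \<times> B"
        using w y sub2 by blast
      moreover from in_box have "(w, m w y, l y) \<in> topspace P"
        using sub by blast
      ultimately have "((w, m w y, l y), y) \<in> F"
        using y(1) by (simp add: F_def T_def)
      then show False
        using in_box sub by force
    qed
    then show ?thesis
      using U W1 W2 by (intro exI[of _ U] exI[of _ "W1 \<inter> W2"]) auto
  qed
  then show ?thesis
    unfolding l_def by (rule lambda_dicontinuousI)
qed

text \<open>Leaves only lambda to be treated, once for the operation and once for its
  opposite.\<close>

lemma ditopological_inverse_semigroupI:
  assumes "topological_inverse_semigroup X m"
    and "lambda_dicontinuous X m" "lambda_dicontinuous X (\<lambda>x y. m y x)"
  shows "ditopological_inverse_semigroup X m"
  unfolding ditopological_inverse_semigroup_def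
proof (intro conjI)
  show "rho_dicontinuous X m"
    using assms(1,3)
    by (simp add: rho_dicontinuous_opposite topological_inverse_semigroup_def)
qed fact+

section \<open>Topological groups\<close>

text \<open>Cancelling \<open>x\<close> on the right in \<open>x \<otimes> y \<otimes> x = x\<close>
  gives \<open>x \<otimes> y = \<one>\<close>.\<close>

lemma (in group) is_inverse_of_iff:
  assumes "x \<in> carrier G" "y \<in> carrier G"
  shows "is_inverse_of (\<otimes>) x y \<longleftrightarrow> y = inv x"
proof
  assume "is_inverse_of (\<otimes>) x y"
  then have "x \<otimes> y \<otimes> x = \<one> \<otimes> x"
    using assms by (simp add: is_inverse_of_def)
  then have "x \<otimes> y = \<one>"
    using assms by (metis m_closed one_closed right_cancel)
  then show "y = inv x"
    using assms by (metis inv_equality inv_inv)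
qed (use assms in \<open>simp add: is_inverse_of_def\<close>)

lemma (in group) inverse_semigroup_carrier:
  shows "inverse_semigroup (carrier G) (\<otimes>)"
    and "x \<in> carrier G \<Longrightarrow> sg_inv (carrier G) (\<otimes>) x = inv x"
proof -
  show isg: "inverse_semigroup (carrier G) (\<otimes>)"
    unfolding inverse_semigroup_def
  proof (intro conjI ballI)
    show "\<exists>!y. y \<in> carrier G \<and> is_inverse_of (\<otimes>) x y" if "x \<in> carrier G" for x
      using that is_inverse_of_iff by (intro ex1I[of _ "inv x"]) auto
  qed (auto simp: m_assoc)
  show "x \<in> carrier G \<Longrightarrow> sg_inv (carrier G) (\<otimes>) x = inv x"
    using is_inverse_of_iff by (intro sg_inv_eqI[OF isg]) auto
qed

lemma ditopological_topological_group:
  assumes "topological_group X G"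
  shows "ditopological_inverse_semigroup X (\<lambda>x y. x \<otimes>\<^bsub>G\<^esub> y)"
proof -
  interpret group G
    using assms by (simp add: topological_group_def)
  have S: "topspace X = carrier G"
    and inv: "continuous_map X X (\<lambda>x. inv\<^bsub>G\<^esub> x)"
    and m: "continuous_map (prod_topology X X) X (\<lambda>(x, y). x \<otimes>\<^bsub>G\<^esub> y)"
    using assms by (simp_all add: topological_group_def)
  have isg: "inverse_semigroup (topspace X) (\<otimes>\<^bsub>G\<^esub>)"
    using inverse_semigroup_carrier(1) by (simp add: S)
  have "continuous_map X X (sg_inv (topspace X) (\<otimes>\<^bsub>G\<^esub>))"
    using inv by (rule continuous_map_eq) (simp add: S inverse_semigroup_carrier(2))
  then have "topological_inverse_semigroup X (\<otimes>\<^bsub>G\<^esub>)"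
    using isg m by (simp add: topological_inverse_semigroup_def)
  moreover have "lambda_dicontinuous X (\<otimes>\<^bsub>G\<^esub>)"
    using isg by (rule lambda_dicontinuous_constant[where e = "\<one>\<^bsub>G\<^esub>"])
      (simp add: S sg_lambda_def inverse_semigroup_carrier(2))
  \<comment> \<open>Lambda of the opposite is rho, which takes the same constant value.\<close>
  moreover have "lambda_dicontinuous X (\<lambda>x y. y \<otimes>\<^bsub>G\<^esub> x)"
    using inverse_semigroup_opposite(1)[OF isg]
    by (rule lambda_dicontinuous_constant[where e = "\<one>\<^bsub>G\<^esub>"])
      (simp add: inverse_semigroup_opposite(3)[OF isg],
        simp add: S sg_rho_def inverse_semigroup_carrier(2))
  ultimately show ?thesis
    by (rule ditopological_inverse_semigroupI)
qed

section \<open>Topological semilattices\<close>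

lemma ditopological_topological_semilattice:
  assumes "topological_semilattice X m"
  shows "ditopological_inverse_semigroup X m"
proof -
  let ?S = "topspace X"
  have ne: "?S \<noteq> {}" and m: "continuous_map (prod_topology X X) X (\<lambda>(x, y). m x y)"
    and assoc: "\<And>x y z. x \<in> ?S \<Longrightarrow> y \<in> ?S \<Longrightarrow> z \<in> ?S \<Longrightarrow> m (m x y) z = m x (m y z)"
    and comm: "\<And>x y. x \<in> ?S \<Longrightarrow> y \<in> ?S \<Longrightarrow> m x y = m y x"
    and idem: "\<And>x. x \<in> ?S \<Longrightarrow> m x x = x"
    using assms by (auto simp: topological_semilattice_def topological_semigroup_def)
  \<comment> \<open>Closure under the operation is contained in its continuity, since a continuous
    map sends carrier into carrier.\<close>
  have closed: "m x y \<in> ?S" if "x \<in> ?S" "y \<in> ?S" for x y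
    using continuous_map_image_subset_topspace[OF m] that by auto
  \<comment> \<open>Both triple products collapse to \<open>m x y\<close>, so being mutually inverse
    means \<open>x = m x y = y\<close>.\<close>
  have inverse_iff: "is_inverse_of m x y \<longleftrightarrow> y = x" if "x \<in> ?S" "y \<in> ?S" for x y
  proof -
    have "m (m x y) x = m x y" "m (m y x) y = m x y"
      using that by (metis assoc comm idem)+
    then show ?thesis
      using that idem by (auto simp: is_inverse_of_def)
  qed
  have isg: "inverse_semigroup ?S m"
    unfolding inverse_semigroup_def
  proof (intro conjI ballI)
    show "\<exists>!y. y \<in> ?S \<and> is_inverse_of m x y" if "x \<in> ?S" for x
      using that inverse_iff by (intro ex1I[of _ x]) auto
  qed (use ne closed assoc in auto)
  have inv: "sg_inv ?S m x = x" if "x \<in> ?S" for x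
    using that inverse_iff by (intro sg_inv_eqI[OF isg]) auto
  have "continuous_map X X (sg_inv ?S m)"
    using continuous_map_id by (rule continuous_map_eq) (simp add: inv)
  then have "topological_inverse_semigroup X m"
    using isg m by (simp add: topological_inverse_semigroup_def)
  moreover have "lambda_dicontinuous X m"
    using isg by (rule lambda_dicontinuous_identity) (simp add: sg_lambda_def inv idem)
  moreover have "lambda_dicontinuous X (\<lambda>x y. m y x)"
    using inverse_semigroup_opposite(1)[OF isg]
    by (rule lambda_dicontinuous_identity)
      (simp add: inverse_semigroup_opposite(3)[OF isg] sg_rho_def inv idem)
  ultimately show ?thesis
    by (rule ditopological_inverse_semigroupI)
qed

section \<open>The four classes together\<close>

theorem theorem4:
  "(\<forall>(X :: 'a topology) (G :: ('a, 'b) monoid_scheme).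
      topological_group X G \<longrightarrow> ditopological_inverse_semigroup X (\<lambda>x y. x \<otimes>\<^bsub>G\<^esub> y)) \<and>
   (\<forall>(X :: 'a topology) m.
      topological_semilattice X m \<longrightarrow> ditopological_inverse_semigroup X m) \<and>
   (\<forall>(X :: 'a topology) m.
      topological_inverse_semigroup X m \<and> compact_space X \<and> Hausdorff_space X \<longrightarrow>
      ditopological_inverse_semigroup X m) \<and>
   (\<forall>(X :: 'a topology) m.
      topological_inverse_semigroup X m \<and> X = discrete_topology (topspace X) \<longrightarrow>
      ditopological_inverse_semigroup X m)"
proof (intro conjI allI impI)
  fix X :: "'a topology" and G :: "('a, 'b) monoid_scheme"
  assume "topological_group X G"
  then show "ditopological_inverse_semigroup X (\<lambda>x y. x \<otimes>\<^bsub>G\<^esub> y)"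
    by (rule ditopological_topological_group)
next
  fix X :: "'a topology" and m
  assume "topological_semilattice X m"
  then show "ditopological_inverse_semigroup X m"
    by (rule ditopological_topological_semilattice)
next
  fix X :: "'a topology" and m
  assume *: "topological_inverse_semigroup X m \<and> compact_space X \<and> Hausdorff_space X"
  then have tis: "topological_inverse_semigroup X m"
    by (rule conjunct1)
  \<comment> \<open>Stated for an arbitrary operation \<open>n\<close>, so that it applies to
    \<open>m\<close> and to its opposite alike.\<close>
  have dic: "lambda_dicontinuous X n" if "topological_inverse_semigroup X n" for n
    using that * by (intro lambda_dicontinuous_compact_Hausdorff) simp_all
  show "ditopological_inverse_semigroup X m"
    using tis dic[OF tis] dic[OF topological_inverse_semigroup_opposite[OF tis]]
    by (rule ditopological_inverse_semigroupI)
next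
  fix X :: "'a topology" and m
  assume *: "topological_inverse_semigroup X m \<and> X = discrete_topology (topspace X)"
  then have tis: "topological_inverse_semigroup X m"
    by (rule conjunct1)
  have dic: "lambda_dicontinuous X n" if "topological_inverse_semigroup X n" for n
  proof (rule lambda_dicontinuous_discrete[OF _ conjunct2[OF *]])
    show "inverse_semigroup (topspace X) n"
      using that unfolding topological_inverse_semigroup_def by (rule conjunct1)
  qed
  show "ditopological_inverse_semigroup X m"
    using tis dic[OF tis] dic[OF topological_inverse_semigroup_opposite[OF tis]]
    by (rule ditopological_inverse_semigroupI)
qed

end
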